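(* Assume that the inverse gamma function satisfies the expansion $$\Gamma^{-1}(x)=u_0(x)+\frac12+O\Big(\frac{1}{u_0(x)\,w(x)}\Big),\qquad x\to\infty,$$ where $w(x):=W\big(\log(x/\sqrt{2\pi})/e\big)$ and $u_0(x):=\log(x/\sqrt{2\pi})/w(x)$. Let $\alpha,\beta>0$, $\mu\ge0$ with $\alpha-\beta(\mu+1)<0$. For $r>0$ put $$S^!_{\alpha,\beta,\mu}(r):=\sum_{n=0}^\infty\frac{(n!)^\alpha}{\big((n!)^\beta+r^2\big)^{\mu+1}}.$$ Then $$S^!_{\alpha,\beta,\mu}(r)\le r^{-2(\mu+1-\alpha/\beta)}\exp\big(o(\log\log r)\big),\qquad r\to\infty.$$
   Context: $\Gamma^{-1}$ denotes the functional inverse of the gamma function on its increasing branch (so that $\Gamma^{-1}(x)\to\infty$ as $x\to\infty$). $W$ is the (principal branch of the) Lambert function, satisfying $W(z)e^{W(z)}=z$. *)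

theory Defs
  imports "HOL-Analysis.Analysis" "HOL-Library.Landau_Symbols"
begin

text \<open>
  The index set below is the half-line \<open>{c..}\<close>, with \<open>c = 1.4616...\<close> the minimiser of \<open>Gamma\<close>
  on the positive axis. The values of \<open>Gamma_inv\<close> below \<open>Gamma c\<close> are unspecified.
\<close>

definition Gamma_incr_branch :: "real set" where
  "Gamma_incr_branch = {a. 0 < a \<and> strict_mono_on {a..} (Gamma :: real \<Rightarrow> real)}"

definition Gamma_inv :: "real \<Rightarrow> real" where
  "Gamma_inv = the_inv_into Gamma_incr_branch Gamma"

text \<open>
  The principal real branch is the inverse of \<open>v * exp v\<close> on \<open>v \<ge> -1\<close>; its values below
  \<open>-exp (-1)\<close> are unspecified.
\<close>

definition Lambert_W :: "real \<Rightarrow> real" where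
  "Lambert_W = the_inv_into {-1..} (\<lambda>v. v * exp v)"

definition w_asymp :: "real \<Rightarrow> real" where
  "w_asymp x = Lambert_W (ln (x / sqrt (2 * pi)) / exp 1)"

definition u0_asymp :: "real \<Rightarrow> real" where
  "u0_asymp x = ln (x / sqrt (2 * pi)) / w_asymp x"

definition S_fact_term :: "real \<Rightarrow> real \<Rightarrow> real \<Rightarrow> real \<Rightarrow> nat \<Rightarrow> real" where
  "S_fact_term \<alpha> \<beta> \<mu> r n =
     (fact n :: real) powr \<alpha> / ((fact n :: real) powr \<beta> + r\<^sup>2) powr (\<mu> + 1)"

definition S_fact :: "real \<Rightarrow> real \<Rightarrow> real \<Rightarrow> real \<Rightarrow> real" where
  "S_fact \<alpha> \<beta> \<mu> r = (\<Sum>n. S_fact_term \<alpha> \<beta> \<mu> r n)"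

text \<open>The series converges in the parameter range of interest, so \<open>suminf\<close> is its true sum.\<close>

lemma summable_S_fact_term:
  fixes \<alpha> \<beta> \<mu> r :: real
  assumes "\<mu> \<ge> 0" "\<alpha> - \<beta> * (\<mu> + 1) < 0"
  shows "summable (S_fact_term \<alpha> \<beta> \<mu> r)"
proof -
  define d where "d = \<beta> * (\<mu> + 1) - \<alpha>"
  have d: "d > 0" using assms by (simp add: d_def)
  define N where "N = nat \<lceil>2 powr (1 / d)\<rceil>"
  have ratio: "norm ((fact (Suc n) :: real) powr (-d)) \<le> 1/2 * norm ((fact n :: real) powr (-d))"
    if "n \<ge> N" for n
  proof -
    have "2 powr (1 / d) \<le> real (Suc n)"
      using that unfolding N_def by linarith
    then have "(2 powr (1 / d)) powr d \<le> real (Suc n) powr d"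
      using d by (intro powr_mono2) auto
    then have "2 \<le> real (Suc n) powr d" using d by (simp add: powr_powr)
    then have "real (Suc n) powr (-d) \<le> 1/2"
      unfolding powr_minus by (simp add: field_simps)
    then have "real (Suc n) powr (-d) * (fact n :: real) powr (-d) \<le> 1/2 * (fact n :: real) powr (-d)"
      by (intro mult_right_mono) auto
    moreover have "(fact (Suc n) :: real) powr (-d) = real (Suc n) powr (-d) * (fact n :: real) powr (-d)"
      by (simp only: fact_Suc of_nat_mult of_nat_fact powr_mult)
    ultimately show ?thesis by simp
  qed
  have "summable (\<lambda>n. (fact n :: real) powr (-d))"
    by (rule summable_ratio_test[of "1/2" N]) (use ratio in auto)
  moreover have "norm (S_fact_term \<alpha> \<beta> \<mu> r n) \<le> (fact n :: real) powr (-d)" for n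
  proof -
    have p: "(fact n :: real) powr \<beta> > 0" by simp
    then have q: "(fact n :: real) powr \<beta> + r\<^sup>2 > 0" by (intro add_pos_nonneg) auto
    have pq: "((fact n :: real) powr \<beta> + r\<^sup>2) powr (\<mu> + 1) * ((fact n :: real) powr \<beta>) powr (\<mu> + 1) > 0"
      using p q by (intro mult_pos_pos) (simp_all only: powr_gt_zero less_imp_neq[THEN not_sym] not_False_eq_True)
    have "((fact n :: real) powr \<beta>) powr (\<mu> + 1) \<le> ((fact n :: real) powr \<beta> + r\<^sup>2) powr (\<mu> + 1)"
      using assms(1) by (intro powr_mono2) auto
    then have "S_fact_term \<alpha> \<beta> \<mu> r n \<le> (fact n :: real) powr \<alpha> / ((fact n :: real) powr \<beta>) powr (\<mu> + 1)"
      unfolding S_fact_term_def using pq by (intro divide_left_mono) auto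
    also have "\<dots> = (fact n :: real) powr (-d)"
      by (simp add: powr_powr d_def powr_diff)
    finally show ?thesis by (simp add: S_fact_term_def)
  qed
  ultimately show ?thesis by (rule summable_comparison_test'[where N = 0])
qed

end

theory Submission
  imports Defs "HOL-Real_Asymp.Real_Asymp"
begin

text \<open>
  With \<open>T = r powr (2 / \<beta>)\<close> and \<open>d = \<beta> * (\<mu> + 1) - \<alpha>\<close>, the \<open>n\<close>-th term divided by
  \<open>r powr (- 2 * (\<mu> + 1 - \<alpha> / \<beta>))\<close> is at most \<open>(n! / T) powr \<alpha>\<close> and at most
  \<open>(n! / T) powr (-d)\<close>. Since factorials at least double at each step, these bounds decay
  geometrically on both sides of the index where \<open>n!\<close> crosses \<open>T\<close>, so the quotient of the sum by
  this power of \<open>r\<close> is bounded by a constant, which is stronger than \<open>exp (o (ln (ln r)))\<close>.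
\<close>

text \<open>The factor 2 on the right absorbs the exceptional step from \<open>0!\<close> to \<open>1!\<close>.\<close>

lemma fact_ge_power_two_mult_fact: "2 ^ k * fact n \<le> (2 * fact (n + k) :: real)"
proof (induction k)
  case (Suc k)
  show ?case
  proof (cases "n + k = 0")
    case False
    then have "2 * (2 * fact (n + k) :: real) \<le> 2 * (real (Suc (n + k)) * fact (n + k))"
      by (intro mult_left_mono mult_right_mono) auto
    also have "real (Suc (n + k)) * fact (n + k) = fact (n + Suc k)" by simp
    finally have "2 * (2 * fact (n + k) :: real) \<le> 2 * fact (n + Suc k)" .
    moreover have "2 ^ Suc k * fact n = 2 * (2 ^ k * fact n :: real)" by simp
    ultimately show ?thesis using Suc by linarith
  qed simp
qed simp

text \<open>Each bound drops one summand of the denominator: \<open>fact n powr \<beta>\<close> for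
  the first, \<open>r\<^sup>2\<close> for the second. \<open>T\<close> is the size of
  \<open>fact n\<close> at which the two summands agree, and \<open>A\<close> is the common value of
  both bounds there.\<close>

lemma S_fact_term_le:
  fixes \<alpha> \<beta> \<mu> r :: real
  assumes "\<beta> > 0" "\<mu> \<ge> 0" "r > 0"
  defines "A \<equiv> r powr (- 2 * (\<mu> + 1 - \<alpha> / \<beta>))" and "T \<equiv> r powr (2 / \<beta>)"
  shows "S_fact_term \<alpha> \<beta> \<mu> r n \<le> A * (fact n / T) powr \<alpha>"
    and "S_fact_term \<alpha> \<beta> \<mu> r n \<le> A * (fact n / T) powr (\<alpha> - \<beta> * (\<mu> + 1))"
proof -
  have r2: "r\<^sup>2 = r powr 2" using assms by simp
  have F: "(fact n :: real) powr \<beta> > 0" by simp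
  have T: "T > 0" using assms by simp
  have pos: "((fact n :: real) powr \<beta> + r\<^sup>2) powr (\<mu> + 1) > 0"
    using add_pos_nonneg[OF F, of "r\<^sup>2"] by simp
  have "(r\<^sup>2) powr (\<mu> + 1) \<le> ((fact n :: real) powr \<beta> + r\<^sup>2) powr (\<mu> + 1)"
    using assms by (intro powr_mono2) auto
  then have "S_fact_term \<alpha> \<beta> \<mu> r n \<le> fact n powr \<alpha> / (r\<^sup>2) powr (\<mu> + 1)"
    unfolding S_fact_term_def using pos assms by (intro divide_left_mono mult_pos_pos) auto
  also have "\<dots> = fact n powr \<alpha> * r powr (- 2 * (\<mu> + 1))"
    unfolding r2 powr_powr using powr_minus_divide[of r "2 * (\<mu> + 1)"] by simp
  also have "r powr (- 2 * (\<mu> + 1)) = A * T powr (- \<alpha>)"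
    unfolding A_def T_def powr_powr powr_add[symmetric] by (simp add: algebra_simps)
  finally show "S_fact_term \<alpha> \<beta> \<mu> r n \<le> A * (fact n / T) powr \<alpha>"
    using T by (simp add: powr_divide powr_minus field_simps)
  have "((fact n :: real) powr \<beta>) powr (\<mu> + 1) \<le> ((fact n :: real) powr \<beta> + r\<^sup>2) powr (\<mu> + 1)"
    using assms by (intro powr_mono2) auto
  then have "S_fact_term \<alpha> \<beta> \<mu> r n \<le> fact n powr \<alpha> / (fact n powr \<beta>) powr (\<mu> + 1)"
    unfolding S_fact_term_def using pos assms by (intro divide_left_mono mult_pos_pos) auto
  also have "\<dots> = fact n powr (\<alpha> - \<beta> * (\<mu> + 1))"
    by (simp add: powr_powr powr_diff)
  \<comment> \<open>The exponents of \<open>r\<close> in \<open>A\<close> and in this power of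
    \<open>T\<close> cancel, so the inserted factor is 1.\<close>
  also have "\<dots> = A * T powr (- (\<alpha> - \<beta> * (\<mu> + 1))) * fact n powr (\<alpha> - \<beta> * (\<mu> + 1))"
  proof -
    have "A * T powr (- (\<alpha> - \<beta> * (\<mu> + 1))) = r powr 0"
      unfolding A_def T_def powr_powr powr_add[symmetric]
      using assms by (intro arg_cong[where f = "(powr) r"]) (simp add: field_simps)
    then show ?thesis using assms by simp
  qed
  finally show "S_fact_term \<alpha> \<beta> \<mu> r n \<le> A * (fact n / T) powr (\<alpha> - \<beta> * (\<mu> + 1))"
    using powr_divide[of "fact n" T "\<alpha> - \<beta> * (\<mu> + 1)"] T
    by (simp only: powr_minus divide_inverse mult_ac)
qed

text \<open>Going down from index \<open>N - 1\<close>, where the factorial is still at most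
  \<open>T\<close>, doubling makes the terms decay geometrically with ratio
  \<open>2 powr (- \<alpha>)\<close>. The bound is therefore independent of both \<open>T\<close>
  and \<open>N\<close>.\<close>

lemma fact_powr_sum_below_le:
  fixes T \<alpha> :: real
  assumes "T > 0" "\<alpha> > 0" and below: "\<And>n. n < N \<Longrightarrow> fact n \<le> T"
  shows "(\<Sum>n<N. (fact n / T) powr \<alpha>) \<le> 2 powr \<alpha> / (1 - 2 powr (- \<alpha>))"
proof -
  define c :: real where "c = 2 powr (- \<alpha>)"
  have c: "0 < c" "c < 1" using assms by (auto simp: c_def intro: powr_less_one)
  have "(\<Sum>n<N. (fact n / T) powr \<alpha>) \<le> (\<Sum>n<N. 2 powr \<alpha> * c ^ (N - Suc n))"
  proof (rule sum_mono)
    fix n assume "n \<in> {..<N}"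
    \<comment> \<open>This index equals \<open>N - 1\<close>, the last one that \<open>below\<close>
      covers; \<open>N - Suc n\<close> counts the doublings from \<open>n\<close> up to it.\<close>
    then have n: "n + (N - Suc n) < N" by auto
    have "2 ^ (N - Suc n) * fact n \<le> 2 * T"
      using fact_ge_power_two_mult_fact[of "N - Suc n" n] below[OF n] by linarith
    then have "fact n / T \<le> 2 / 2 ^ (N - Suc n)"
      using assms by (simp add: field_simps)
    then have "(fact n / T) powr \<alpha> \<le> (2 / 2 ^ (N - Suc n)) powr \<alpha>"
      using assms by (intro powr_mono2) auto
    also have "\<dots> = 2 powr \<alpha> * c ^ (N - Suc n)"
      by (simp add: c_def powr_divide powr_minus powr_power powr_powr field_simps flip: powr_realpow)
    finally show "(fact n / T) powr \<alpha> \<le> 2 powr \<alpha> * c ^ (N - Suc n)" .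
  qed
  \<comment> \<open>Reversing the order of summation leaves a partial sum of the geometric
    series.\<close>
  also have "\<dots> = 2 powr \<alpha> * (\<Sum>n<N. c ^ n)"
    by (simp only: sum_distrib_left[symmetric] sum.nat_diff_reindex)
  also have "\<dots> \<le> 2 powr \<alpha> * (\<Sum>n. c ^ n)"
    using c by (intro mult_left_mono sum_le_suminf summable_geometric) auto
  finally show ?thesis using c by (simp add: suminf_geometric c_def)
qed

text \<open>From index \<open>N\<close> on, \<open>fact (N + n) / T\<close> is at least
  \<open>2 ^ n / 2\<close>, so the negative power decays geometrically. The sequence
  \<open>f\<close> stands for the tail of the series, shifted to start at 0.\<close>

lemma fact_powr_neg_suminf_above_le:
  fixes T d :: real
  assumes "T > 0" "d > 0" and above: "T \<le> fact N"
    and "summable f" and f: "\<And>n. f n \<le> A * (fact (N + n) / T) powr (- d)" and "A \<ge> 0"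
  shows "(\<Sum>n. f n) \<le> A * (2 powr d / (1 - 2 powr (- d)))"
proof -
  define c :: real where "c = 2 powr (- d)"
  have c: "0 < c" "c < 1" using assms by (auto simp: c_def intro: powr_less_one)
  have "f n \<le> A * 2 powr d * c ^ n" for n
  proof -
    have "2 ^ n * T \<le> 2 ^ n * fact N" using above by simp
    then have "2 ^ n * T \<le> 2 * fact (N + n)"
      using fact_ge_power_two_mult_fact[of n N] by linarith
    then have "2 ^ n / 2 \<le> fact (N + n) / T"
      using assms by (simp add: field_simps)
    then have "(fact (N + n) / T) powr (- d) \<le> (2 ^ n / 2) powr (- d)"
      using assms by (intro powr_mono2') auto
    also have "\<dots> = 2 powr d * c ^ n"
      by (simp add: c_def powr_divide powr_minus powr_power powr_powr field_simps flip: powr_realpow)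
    finally have "A * (fact (N + n) / T) powr (- d) \<le> A * (2 powr d * c ^ n)"
      using assms by (intro mult_left_mono) auto
    with f[of n] show ?thesis by simp
  qed
  then have "(\<Sum>n. f n) \<le> (\<Sum>n. A * 2 powr d * c ^ n)"
    using c assms by (intro suminf_le summable_mult summable_geometric) auto
  also have "\<dots> = A * 2 powr d * (\<Sum>n. c ^ n)"
    using c by (intro suminf_mult summable_geometric) auto
  finally show ?thesis using c by (simp add: suminf_geometric c_def)
qed

text \<open>The series is split at the first index whose factorial reaches \<open>T\<close>: the
  first termwise bound controls the head, the second the tail. The factor after the power of
  \<open>r\<close> depends only on the parameters.\<close>

lemma S_fact_le:
  fixes \<alpha> \<beta> \<mu> r :: real
  assumes "\<alpha> > 0" "\<beta> > 0" "\<mu> \<ge> 0" "\<alpha> - \<beta> * (\<mu> + 1) < 0" "r > 0"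
  defines "d \<equiv> \<beta> * (\<mu> + 1) - \<alpha>"
  shows "S_fact \<alpha> \<beta> \<mu> r \<le> r powr (- 2 * (\<mu> + 1 - \<alpha> / \<beta>)) *
    (2 powr \<alpha> / (1 - 2 powr (- \<alpha>)) + 2 powr d / (1 - 2 powr (- d)))"
proof -
  define A where "A = r powr (- 2 * (\<mu> + 1 - \<alpha> / \<beta>))"
  define T where "T = r powr (2 / \<beta>)"
  define N where "N = (LEAST n. T \<le> fact n)"
  let ?f = "S_fact_term \<alpha> \<beta> \<mu> r"
  have T: "T > 0" and A: "A \<ge> 0" using assms by (simp_all add: T_def A_def)
  \<comment> \<open>Some factorial must reach \<open>T\<close> for \<open>LEAST\<close> to be
    meaningful; \<open>fact n \<ge> n\<close> supplies a witness.\<close>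
  have "T \<le> fact (nat \<lceil>T\<rceil>)"
    using fact_ge_self[of "nat \<lceil>T\<rceil>"] real_nat_ceiling_ge[of T]
    by (metis of_nat_fact of_nat_le_iff order_trans)
  then have above: "T \<le> fact N" unfolding N_def by (rule LeastI)
  have below: "fact n \<le> T" if "n < N" for n
    using not_less_Least[of n "\<lambda>n. T \<le> fact n"] that unfolding N_def by auto
  have summable: "summable ?f" using assms by (intro summable_S_fact_term) auto
  have "(\<Sum>n<N. ?f n) \<le> A * (\<Sum>n<N. (fact n / T) powr \<alpha>)"
    unfolding sum_distrib_left A_def T_def using assms by (intro sum_mono S_fact_term_le) auto
  also have "\<dots> \<le> A * (2 powr \<alpha> / (1 - 2 powr (- \<alpha>)))"
    using T A assms below by (intro mult_left_mono fact_powr_sum_below_le) auto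
  finally have head: "(\<Sum>n<N. ?f n) \<le> A * (2 powr \<alpha> / (1 - 2 powr (- \<alpha>)))" .
  have "?f (N + n) \<le> A * (fact (N + n) / T) powr (- d)" for n
    using S_fact_term_le(2)[of \<beta> \<mu> r \<alpha> "N + n"] assms by (simp add: A_def T_def d_def)
  moreover have "summable (\<lambda>n. ?f (N + n))"
    using summable_ignore_initial_segment[OF summable, of N] by (simp add: add.commute)
  ultimately have "(\<Sum>n. ?f (N + n)) \<le> A * (2 powr d / (1 - 2 powr (- d)))"
    using T A above assms by (intro fact_powr_neg_suminf_above_le) auto
  with head show ?thesis
    unfolding S_fact_def A_def suminf_split_initial_segment[OF summable, of N]
    by (simp add: add.commute distrib_left)
qed

theorem theorem1p4:
  fixes \<alpha> \<beta> \<mu> :: real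
  assumes Gamma_inv_expansion:
      "(\<lambda>x. Gamma_inv x - (u0_asymp x + 1 / 2)) \<in> O[at_top](\<lambda>x. 1 / (u0_asymp x * w_asymp x))"
    and "\<alpha> > 0" "\<beta> > 0" "\<mu> \<ge> 0"
    and "\<alpha> - \<beta> * (\<mu> + 1) < 0"
  shows "\<exists>g :: real \<Rightarrow> real. g \<in> o[at_top](\<lambda>r. ln (ln r)) \<and>
    (\<forall>\<^sub>F r in at_top. S_fact \<alpha> \<beta> \<mu> r \<le> r powr (- 2 * (\<mu> + 1 - \<alpha> / \<beta>)) * exp (g r))"
proof -
  define d where "d = \<beta> * (\<mu> + 1) - \<alpha>"
  define C where "C = 2 powr \<alpha> / (1 - 2 powr (- \<alpha>)) + 2 powr d / (1 - 2 powr (- d))"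
  have "2 powr (- \<alpha>) < 1" "2 powr (- d) < 1"
    using assms by (auto simp: d_def intro: powr_less_one)
  then have C: "C > 0" unfolding C_def by (intro add_pos_pos divide_pos_pos) auto
  \<comment> \<open>The constant function \<open>ln C\<close> serves as \<open>g\<close>, since
    \<open>ln (ln r)\<close> tends to infinity.\<close>
  have "(\<lambda>_. ln C) \<in> o[at_top](\<lambda>r::real. ln (ln r))" by real_asymp
  moreover have "\<forall>\<^sub>F r in at_top.
      S_fact \<alpha> \<beta> \<mu> r \<le> r powr (- 2 * (\<mu> + 1 - \<alpha> / \<beta>)) * exp (ln C)"
    using eventually_gt_at_top[of 0]
  proof eventually_elim
    case (elim r)
    with S_fact_le[of \<alpha> \<beta> \<mu> r] C assms show ?case by (simp add: C_def d_def)
  qed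
  ultimately show ?thesis by blast
qed

end
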